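(* Let $\mathbf{p}_1,\mathbf{p}_2,\mathbf{p}_3\in\mathbb{R}^2$ be three non-collinear points, let $T\in(0,1)$ be the parameter value of the minimum-energy quadratic curve through them (defined in the context), and let $\mathbf{r}(t)=\mathbf{a}_1t^2+\mathbf{a}_2t+\mathbf{a}_3$ be that curve, so that $\mathbf{r}(0)=\mathbf{p}_1$, $\mathbf{r}(T)=\mathbf{p}_2$, $\mathbf{r}(1)=\mathbf{p}_3$. Put $\mathbf{s}_2=\mathbf{p}_2-\mathbf{p}_1$, $\mathbf{s}_3=\mathbf{p}_3-\mathbf{p}_1$, $\mathbf{r}_1=T\mathbf{s}_3-\mathbf{s}_2$, $\mathbf{r}_2=T^2\mathbf{s}_3-\mathbf{s}_2$, let $\theta$ be the angle between the vectors $\mathbf{r}_1$ and $\mathbf{r}_2$, and let $$\rho=\sqrt{4|\mathbf{r}_1|^2-4|\mathbf{r}_1||\mathbf{r}_2|\cos\theta+|\mathbf{r}_2|^2}.$$ Then the arc length $l=\int_0^1|\dot{\mathbf{r}}(t)|\,dt$ of the curve between $\mathbf{p}_1$ and $\mathbf{p}_3$ is $$l=\frac{1}{4|\mathbf{r}_1|(T-T^2)}\left(|\mathbf{r}_2|^2\cos\theta+\bigl(2|\mathbf{r}_1|-|\mathbf{r}_2|\cos\theta\bigr)\rho+|\mathbf{r}_2|^2\sin^2\theta\,\log\frac{2|\mathbf{r}_1|-|\mathbf{r}_2|\cos\theta+\rho}{|\mathbf{r}_2|(1-\cos\theta)}\right).$$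
   Context: $|\cdot|$ is the Euclidean norm on $\mathbb{R}^2$, $\log$ is the natural logarithm, and dots are derivatives with respect to the parameter $t$. Normalization: set $\widehat{\mathbf{p}}_i=(\mathbf{p}_i-\mathbf{p}_1)/|\mathbf{p}_3-\mathbf{p}_1|$ for $i=1,2,3$, write $\widehat{\mathbf{p}}_3=(u,v)$, let $A=\begin{pmatrix}u&v\\-v&u\end{pmatrix}$ be the rotation taking $\widehat{\mathbf{p}}_3$ to $(1,0)$, and put $\mathbf{q}_2=A\widehat{\mathbf{p}}_2=({q_2}_x,{q_2}_y)$. Minimum-energy quadratic: $T$ is the root lying in $(0,1)$ of the cubic equation $$T^3-\tfrac32T^2+\bigl({q_2}_x-|\mathbf{q}_2|^2\bigr)T+\tfrac12|\mathbf{q}_2|^2=0,$$ and the minimum-energy quadratic curve is $\mathbf{r}(t)=\mathbf{a}_1t^2+\mathbf{a}_2t+\mathbf{a}_3$ with $$\mathbf{a}_1=\frac{\mathbf{p}_2-\mathbf{p}_1-(\mathbf{p}_3-\mathbf{p}_1)T}{T^2-T},\qquad \mathbf{a}_2=\mathbf{p}_3-\mathbf{p}_1-\mathbf{a}_1,\qquad \mathbf{a}_3=\mathbf{p}_1 .$$ *)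

theory Defs
  imports "HOL-Analysis.Analysis"
begin

definition vangle :: "real ^ 2 \<Rightarrow> real ^ 2 \<Rightarrow> real" where
  "vangle x y = arccos ((x \<bullet> y) / (norm x * norm y))"

definition normalized :: "real ^ 2 \<Rightarrow> real ^ 2 \<Rightarrow> real ^ 2 \<Rightarrow> real ^ 2" where
  "normalized p1 p3 p = (1 / norm (p3 - p1)) *\<^sub>R (p - p1)"

definition rotation_to_e1 :: "real ^ 2 \<Rightarrow> real ^ 2 ^ 2" where
  "rotation_to_e1 w = vector [vector [w $ 1, w $ 2], vector [- (w $ 2), w $ 1]]"

definition q2 :: "real ^ 2 \<Rightarrow> real ^ 2 \<Rightarrow> real ^ 2 \<Rightarrow> real ^ 2" where
  "q2 p1 p2 p3 = rotation_to_e1 (normalized p1 p3 p3) *v normalized p1 p3 p2"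

definition energy_cubic :: "real ^ 2 \<Rightarrow> real \<Rightarrow> real" where
  "energy_cubic q T =
     T ^ 3 - 3 / 2 * T ^ 2 + (q $ 1 - (norm q)\<^sup>2) * T + 1 / 2 * (norm q)\<^sup>2"

(* The description is proper for non-collinear points; see min_energy_param_props below. *)
definition min_energy_param :: "real ^ 2 \<Rightarrow> real ^ 2 \<Rightarrow> real ^ 2 \<Rightarrow> real" where
  "min_energy_param p1 p2 p3 =
     (THE T. 0 < T \<and> T < 1 \<and> energy_cubic (q2 p1 p2 p3) T = 0)"

definition min_energy_curve ::
  "real ^ 2 \<Rightarrow> real ^ 2 \<Rightarrow> real ^ 2 \<Rightarrow> real \<Rightarrow> real ^ 2" where
  "min_energy_curve p1 p2 p3 t =
     (let T = min_energy_param p1 p2 p3;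
          a1 = (1 / (T\<^sup>2 - T)) *\<^sub>R (p2 - p1 - T *\<^sub>R (p3 - p1));
          a2 = p3 - p1 - a1;
          a3 = p1
      in t\<^sup>2 *\<^sub>R a1 + t *\<^sub>R a2 + a3)"

lemma norm2_sq: "(norm (x :: real ^ 2))\<^sup>2 = (x $ 1)\<^sup>2 + (x $ 2)\<^sup>2"
  by (simp add: norm_vec_def L2_set_def UNIV_2)

lemma energy_cubic_ex1:
  assumes "q \<noteq> 0" and "q \<noteq> vector [1, 0]"
  shows "\<exists>!T. 0 < T \<and> T < 1 \<and> energy_cubic q T = 0"
proof -
  define f where "f = energy_cubic q"
  define m where "m = (norm q)\<^sup>2"
  have f: "f T = T ^ 3 - 3 / 2 * T ^ 2 + (q $ 1 - m) * T + 1 / 2 * m" for T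
    by (simp add: f_def energy_cubic_def m_def)
  have m: "m > 0" using assms by (simp add: m_def)
  have "q $ 1 \<noteq> 1 \<or> q $ 2 \<noteq> 0"
    using assms(2) by (auto simp: vec_eq_iff forall_2)
  then have "(q $ 1 - 1)\<^sup>2 + (q $ 2)\<^sup>2 > 0"
    by (simp add: sum_power2_gt_zero_iff)
  moreover have "f 1 = - ((q $ 1 - 1)\<^sup>2 + (q $ 2)\<^sup>2) / 2"
    unfolding f m_def norm2_sq by (simp add: power2_eq_square field_simps)
  ultimately have f1: "f 1 < 0" by simp
  have f0: "f 0 > 0" using m by (simp add: f)
  have "\<exists>x\<ge>0. x \<le> 1 \<and> f x = 0"
    by (rule IVT2) (use f0 f1 in \<open>auto simp: f intro!: continuous_intros\<close>)
  then obtain x where x: "0 \<le> x" "x \<le> 1" "f x = 0" by blast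
  have x': "0 < x" "x < 1" using x f0 f1 by (metis less_irrefl order_le_less)+
  have "y = x" if y: "0 < y" "y < 1" "f y = 0" for y
  proof (rule ccontr)
    assume "y \<noteq> x"
    define z where "z = 3 / 2 - x - y"
    have "(x - y) * (x\<^sup>2 + x * y + y\<^sup>2 - 3 / 2 * (x + y) + (q $ 1 - m)) = f x - f y"
      by (simp add: f power2_eq_square power3_eq_cube field_simps)
    then have c: "q $ 1 - m = 3 / 2 * (x + y) - (x\<^sup>2 + x * y + y\<^sup>2)"
      using \<open>y \<noteq> x\<close> x y by simp
    have d: "1 / 2 * m = - (x ^ 3 - 3 / 2 * x ^ 2 + (q $ 1 - m) * x)"
      using x(3) unfolding f by simp
    have ff: "f t = (t - x) * (t - y) * (t - z)" for t
      unfolding f d c z_def by (simp add: power2_eq_square power3_eq_cube field_simps)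
    have "z < 0"
      using f0 x' y unfolding ff by (simp add: zero_less_mult_iff mult_less_0_iff)
    moreover have "z > 1"
    proof -
      have "(1 - x) * (1 - y) > 0" using x' y by simp
      then show ?thesis using f1 x' y unfolding ff by (auto simp: mult_less_0_iff)
    qed
    ultimately show False by simp
  qed
  then show ?thesis using x x' unfolding f_def by blast
qed

lemma min_energy_param_props:
  assumes "\<not> collinear {p1, p2, p3}"
  shows "0 < min_energy_param p1 p2 p3" and "min_energy_param p1 p2 p3 < 1"
    and "energy_cubic (q2 p1 p2 p3) (min_energy_param p1 p2 p3) = 0"
proof -
  have ne: "p1 \<noteq> p2" "p1 \<noteq> p3" "p2 \<noteq> p3"
    using assms by (auto simp: insert_commute)
  define w where "w = normalized p1 p3 p3"
  define v where "v = normalized p1 p3 p2"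
  have "norm w = 1" using ne by (simp add: w_def normalized_def)
  then have w: "w $ 1 * w $ 1 + w $ 2 * w $ 2 = 1"
    using norm2_sq[of w] by (simp add: power2_eq_square)
  have v0: "v \<noteq> 0" "v \<noteq> w" using ne by (auto simp: v_def w_def normalized_def)
  have q: "q2 p1 p2 p3 $ 1 = w $ 1 * v $ 1 + w $ 2 * v $ 2"
          "q2 p1 p2 p3 $ 2 = - (w $ 2) * v $ 1 + w $ 1 * v $ 2"
    by (simp_all add: q2_def rotation_to_e1_def matrix_vector_mult_def sum_2
        flip: w_def v_def)
  have inv: "v $ 1 = w $ 1 * q2 p1 p2 p3 $ 1 - w $ 2 * q2 p1 p2 p3 $ 2"
            "v $ 2 = w $ 2 * q2 p1 p2 p3 $ 1 + w $ 1 * q2 p1 p2 p3 $ 2"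
    unfolding q using w by algebra+
  have "q2 p1 p2 p3 \<noteq> 0" 
    using v0(1) inv by (auto simp: vec_eq_iff forall_2)
  moreover have "q2 p1 p2 p3 \<noteq> vector [1, 0]"
    using v0(2) inv by (auto simp: vec_eq_iff forall_2)
  ultimately have "\<exists>!T. 0 < T \<and> T < 1 \<and> energy_cubic (q2 p1 p2 p3) T = 0"
    by (rule energy_cubic_ex1)
  from theI'[OF this]
  show "0 < min_energy_param p1 p2 p3" and "min_energy_param p1 p2 p3 < 1"
    and "energy_cubic (q2 p1 p2 p3) (min_energy_param p1 p2 p3) = 0"
    by (simp_all add: min_energy_param_def)
qed

lemma min_energy_curve_interpolates:
  assumes "\<not> collinear {p1, p2, p3}"
  shows "min_energy_curve p1 p2 p3 0 = p1"
    and "min_energy_curve p1 p2 p3 (min_energy_param p1 p2 p3) = p2"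
    and "min_energy_curve p1 p2 p3 1 = p3"
proof -
  define T where "T = min_energy_param p1 p2 p3"
  have T: "T\<^sup>2 - T \<noteq> 0"
    using min_energy_param_props[OF assms] by (simp add: T_def power2_eq_square)
  show "min_energy_curve p1 p2 p3 0 = p1" "min_energy_curve p1 p2 p3 1 = p3"
    by (simp_all add: min_energy_curve_def Let_def)
  define a where "a = (1 / (T\<^sup>2 - T)) *\<^sub>R (p2 - p1 - T *\<^sub>R (p3 - p1))"
  have "(T\<^sup>2 - T) *\<^sub>R a = p2 - p1 - T *\<^sub>R (p3 - p1)"
    using T by (simp add: a_def)
  then have "T\<^sup>2 *\<^sub>R a + T *\<^sub>R (p3 - p1 - a) + p1 = p2"
    by (simp add: algebra_simps)
  then show "min_energy_curve p1 p2 p3 (min_energy_param p1 p2 p3) = p2"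
    by (simp add: min_energy_curve_def Let_def a_def flip: T_def)
qed

end

(*
  The velocity of the curve is (2 t r1 - r2) / (T - T^2). With a = 2 |r1|, b = |r2| cos \<theta> and
  D = |r2|^2 sin^2 \<theta>, the speed is sqrt ((a t - b)^2 + D) / (T - T^2), which has an elementary
  antiderivative. Non-collinearity of the points makes r1 and r2 linearly independent, so D > 0.
*)

theory Submission
  imports Defs
begin

text \<open>Half of \<open>F\<close> is the classical antiderivative of
  \<open>sqrt (x\<^sup>2 + D)\<close>. The substitution \<open>x = a * t - b\<close> contributes the
  further factor \<open>a\<close> in the denominator.\<close>

lemma has_integral_sqrt_quadratic:
  fixes a b D :: real
  defines "F \<equiv> (\<lambda>x. x * sqrt (x\<^sup>2 + D) + D * ln (x + sqrt (x\<^sup>2 + D)))"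
  assumes "a > 0" and "D > 0"
  shows "((\<lambda>t. sqrt ((a * t - b)\<^sup>2 + D)) has_integral (F (a - b) - F (- b)) / (2 * a)) {0..1}"
proof -
  have F: "(F has_real_derivative 2 * sqrt (x\<^sup>2 + D)) (at x)" for x
  proof -
    define q where "q = sqrt (x\<^sup>2 + D)"
    have pos: "x\<^sup>2 + D > 0" using \<open>D > 0\<close> by (simp add: add_nonneg_pos)
    have q: "q > 0" "q\<^sup>2 = x\<^sup>2 + D" using pos by (auto simp: q_def)
    \<comment> \<open>Since \<open>D > 0\<close>, the root dominates \<open>x\<close> in absolute
      value, so the argument of the logarithm is positive even for negative
      \<open>x\<close>.\<close>
    have "\<bar>x\<bar> < q" unfolding q_def by (rule real_less_rsqrt) (use \<open>D > 0\<close> in simp)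
    then have xq: "x + q > 0" by linarith
    have "(F has_real_derivative q + x * (x / q) + D * ((1 + x / q) / (x + q))) (at x)"
      unfolding F_def using pos xq
      by (auto intro!: derivative_eq_intros simp: q_def divide_simps)
    moreover have "(1 + x / q) / (x + q) = 1 / q"
    proof -
      have "1 + x / q = (x + q) / q" using q(1) by (simp add: field_simps)
      then show ?thesis using xq by simp
    qed
    moreover have "q + x * (x / q) + D * (1 / q) = 2 * q"
      using q by (simp add: field_simps power2_eq_square)
    ultimately show ?thesis by (simp only: q_def)
  qed
  have "((\<lambda>t. sqrt ((a * t - b)\<^sup>2 + D)) has_integral
      F (a * 1 - b) / (2 * a) - F (a * 0 - b) / (2 * a)) {0..1}"
  proof (rule fundamental_theorem_of_calculus)
    fix t :: real
    have "((\<lambda>t. F (a * t - b) / (2 * a)) has_real_derivative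
        2 * sqrt ((a * t - b)\<^sup>2 + D) * a / (2 * a)) (at t)"
      by (rule DERIV_cdivide, rule DERIV_chain2[OF F]) (auto intro!: derivative_eq_intros)
    then show "((\<lambda>t. F (a * t - b) / (2 * a)) has_vector_derivative
        sqrt ((a * t - b)\<^sup>2 + D)) (at t within {0..1})"
      using \<open>a > 0\<close>
      by (simp add: has_real_derivative_iff_has_vector_derivative has_vector_derivative_at_within)
  qed simp
  then show ?thesis by (simp add: diff_divide_distrib)
qed

text \<open>Completing the square in \<open>t\<close> reduces the norm to the root of a quadratic
  with \<open>a = 2 * norm x\<close> and \<open>b = norm y * cos \<theta>\<close>. The angle enters
  only through its cosine and squared sine, so any \<theta> satisfying \<open>ang\<close> will
  do.\<close>

lemma integral_norm_linear:
  fixes x y :: "'a::real_inner" and \<theta> :: real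
  assumes "\<not> collinear {0, x, y}" and ang: "norm x * norm y * cos \<theta> = x \<bullet> y"
  shows "integral {0..1} (\<lambda>t. norm ((2 * t) *\<^sub>R x - y)) =
    1 / (4 * norm x) *
    ((norm y)\<^sup>2 * cos \<theta> + (2 * norm x - norm y * cos \<theta>) * norm (2 *\<^sub>R x - y)
      + (norm y)\<^sup>2 * (sin \<theta>)\<^sup>2 *
          ln ((2 * norm x - norm y * cos \<theta> + norm (2 *\<^sub>R x - y)) / (norm y * (1 - cos \<theta>))))"
proof -
  define A B c where "A = norm x" and "B = norm y" and "c = cos \<theta>"
  define D where "D = B\<^sup>2 * (1 - c\<^sup>2)"
  define F where "F = (\<lambda>z. z * sqrt (z\<^sup>2 + D) + D * ln (z + sqrt (z\<^sup>2 + D)))"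
  have "x \<noteq> 0" "y \<noteq> 0" using assms(1) by (auto simp: collinear_lemma)
  then have pos: "A > 0" "B > 0" by (simp_all add: A_def B_def)
  \<comment> \<open>Equality in Cauchy-Schwarz would force collinearity. Hence the cosine differs
    from 1 and -1, which makes \<open>D\<close> positive.\<close>
  have "\<bar>x \<bullet> y\<bar> \<noteq> norm x * norm y"
    using assms(1) norm_cauchy_schwarz_equal by blast
  moreover have "\<bar>x \<bullet> y\<bar> = A * B * \<bar>c\<bar>"
    using pos by (simp add: A_def B_def c_def abs_mult flip: ang)
  ultimately have "\<bar>c\<bar> \<noteq> 1" by (auto simp: A_def B_def)
  then have c: "\<bar>c\<bar> < 1" unfolding c_def using abs_cos_le_one[of \<theta>] by linarith
  then have D: "D > 0" using pos by (simp add: D_def abs_square_less_1)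
  have nrm: "norm ((2 * t) *\<^sub>R x - y) = sqrt ((2 * A * t - B * c)\<^sup>2 + D)" for t
  proof -
    have "(norm ((2 * t) *\<^sub>R x - y))\<^sup>2 = 4 * t\<^sup>2 * A\<^sup>2 - 4 * t * (x \<bullet> y) + B\<^sup>2"
      unfolding A_def B_def power2_norm_eq_inner
      by (simp add: inner_diff_left inner_diff_right inner_commute[of y x] power2_eq_square algebra_simps)
    also have "\<dots> = (2 * A * t - B * c)\<^sup>2 + D"
      unfolding D_def ang[symmetric] A_def[symmetric] B_def[symmetric] c_def[symmetric]
      by (simp add: power2_eq_square algebra_simps)
    finally show ?thesis by (metis norm_ge_zero real_sqrt_unique)
  qed
  define \<rho> where "\<rho> = norm (2 *\<^sub>R x - y)"
  \<comment> \<open>The two roots in \<open>F\<close> are the values of \<open>nrm\<close> at the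
    endpoints 1 and 0. At 0 the norm is that of \<open>- y\<close>, so the root collapses to
    \<open>B\<close> and the argument of the logarithm to \<open>B * (1 - c)\<close>.\<close>
  have rho: "sqrt ((2 * A - B * c)\<^sup>2 + D) = \<rho>"
    using nrm[of 1] by (simp add: \<rho>_def)
  have B: "sqrt ((- (B * c))\<^sup>2 + D) = B"
    using nrm[of 0] by (simp add: B_def)
  \<comment> \<open>Both arguments must be positive for the difference of logarithms to merge into
    the logarithm of a quotient.\<close>
  have "\<bar>2 * A - B * c\<bar> < \<rho>"
    unfolding rho[symmetric] by (rule real_less_rsqrt) (use D in simp)
  then have p1: "2 * A - B * c + \<rho> > 0" by linarith
  have p2: "B * (1 - c) > 0" using pos c by simp
  have "integral {0..1} (\<lambda>t. norm ((2 * t) *\<^sub>R x - y)) = (F (2 * A - B * c) - F (- (B * c))) / (4 * A)"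
    unfolding nrm using has_integral_sqrt_quadratic[of "2 * A" D "B * c"] pos D
    by (simp add: F_def integral_unique)
  also have "F (2 * A - B * c) - F (- (B * c)) =
      B\<^sup>2 * c + (2 * A - B * c) * \<rho> + D * (ln (2 * A - B * c + \<rho>) - ln (B * (1 - c)))"
    unfolding F_def rho B by (simp add: algebra_simps power2_eq_square)
  also have "ln (2 * A - B * c + \<rho>) - ln (B * (1 - c)) = ln ((2 * A - B * c + \<rho>) / (B * (1 - c)))"
    by (rule ln_divide_pos[OF p1 p2, symmetric])
  finally show ?thesis
    by (simp add: A_def B_def c_def D_def \<rho>_def sin_squared_eq)
qed

text \<open>By Cauchy-Schwarz the quotient lies in [-1, 1], where \<open>cos\<close> undoes
  \<open>arccos\<close>. If a vector is zero, both sides vanish, whatever the angle is.\<close>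

lemma norm_mult_cos_vangle: "norm x * norm y * cos (vangle x y) = x \<bullet> y"
proof (cases "x = 0 \<or> y = 0")
  case False
  have "\<bar>x \<bullet> y\<bar> \<le> norm x * norm y" by (rule Cauchy_Schwarz_ineq2)
  then have "\<bar>(x \<bullet> y) / (norm x * norm y)\<bar> \<le> 1"
    using False by (simp add: abs_mult divide_le_eq_1)
  then show ?thesis
    using False by (simp add: vangle_def cos_arccos_abs)
qed auto

theorem mainTheorem2:
  fixes p1 p2 p3 s2 s3 r1 r2 :: "real ^ 2"
    and r :: "real \<Rightarrow> real ^ 2"
    and T \<theta> \<rho> l :: real
  assumes "\<not> collinear {p1, p2, p3}"
    and "T = min_energy_param p1 p2 p3"
    and "r = min_energy_curve p1 p2 p3"
    and "s2 = p2 - p1"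
    and "s3 = p3 - p1"
    and "r1 = T *\<^sub>R s3 - s2"
    and "r2 = T\<^sup>2 *\<^sub>R s3 - s2"
    and "\<theta> = vangle r1 r2"
    and "\<rho> = sqrt (4 * (norm r1)\<^sup>2 - 4 * norm r1 * norm r2 * cos \<theta> + (norm r2)\<^sup>2)"
    and "l = integral {0..1} (\<lambda>t. norm (vector_derivative r (at t)))"
  shows "l = 1 / (4 * norm r1 * (T - T\<^sup>2)) *
    ((norm r2)\<^sup>2 * cos \<theta> + (2 * norm r1 - norm r2 * cos \<theta>) * \<rho>
      + (norm r2)\<^sup>2 * (sin \<theta>)\<^sup>2 *
          ln ((2 * norm r1 - norm r2 * cos \<theta> + \<rho>) / (norm r2 * (1 - cos \<theta>))))"
proof -
  define k where "k = T - T\<^sup>2"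
  have T: "0 < T" "T < 1" using min_energy_param_props[OF assms(1)] assms(2) by auto
  then have k: "k > 0" by (simp add: k_def power2_eq_square)
  \<comment> \<open>\<open>collinear_3\<close> moves the middle point to the origin, hence the order
    \<open>p2 p1 p3\<close>.\<close>
  have s: "\<not> collinear {0, s2, s3}"
    using assms(1) collinear_3[of p2 p1 p3] by (simp add: assms(4,5) insert_commute)
  have nc: "\<not> collinear {0, r1, r2}"
  proof
    assume "collinear {0, r1, r2}"
    \<comment> \<open>A nontrivial linear relation covers all three cases of
      \<open>collinear_lemma\<close> at once: either vector zero, or one a multiple of the
      other.\<close>
    then obtain u v where "u *\<^sub>R r1 + v *\<^sub>R r2 = 0" "u \<noteq> 0 \<or> v \<noteq> 0"
      unfolding collinear_lemma
      by (metis add.commute add_cancel_right_left scaleR_eq_0_iff scaleR_minus_left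
          scaleR_one zero_neq_one add.right_inverse)
    then have uv: "(u * T + v * T\<^sup>2) *\<^sub>R s3 = (u + v) *\<^sub>R s2"
      by (simp add: assms(6,7) algebra_simps)
    show False
    proof (cases "u + v = 0")
      case True
      \<comment> \<open>Here \<open>v = - u\<close>, so \<open>u\<close> is nonzero and the
        coefficient of \<open>s3\<close> cannot vanish.\<close>
      then have "u * T + v * T\<^sup>2 = u * k" by (simp add: k_def algebra_simps flip: eq_neg_iff_add_eq_0)
      with True uv k \<open>u \<noteq> 0 \<or> v \<noteq> 0\<close> have "s3 = 0" by auto
      with s show False by (simp add: collinear_lemma)
    next
      case False
      then have "s2 = ((u * T + v * T\<^sup>2) / (u + v)) *\<^sub>R s3"
        using uv by (simp add: eq_vector_fraction_iff)
      with s show False by (metis collinear_lemma insert_commute)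
    qed
  qed
  have ang: "norm r1 * norm r2 * cos \<theta> = r1 \<bullet> r2"
    by (simp add: assms(8) norm_mult_cos_vangle)
  \<comment> \<open>The radicand of \<rho> is the law of cosines for \<open>2 *\<^sub>R r1\<close>
    and \<open>r2\<close>; thus \<rho> is \<open>k\<close> times the speed at
    \<open>t = 1\<close>.\<close>
  have "(norm (2 *\<^sub>R r1 - r2))\<^sup>2 = 4 * (norm r1)\<^sup>2 - 4 * (r1 \<bullet> r2) + (norm r2)\<^sup>2"
    unfolding power2_norm_eq_inner
    by (simp add: inner_diff_left inner_diff_right inner_commute[of r2 r1])
  then have "(norm (2 *\<^sub>R r1 - r2))\<^sup>2 =
      4 * (norm r1)\<^sup>2 - 4 * norm r1 * norm r2 * cos \<theta> + (norm r2)\<^sup>2"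
    by (simp add: mult.assoc flip: ang)
  then have rho: "\<rho> = norm (2 *\<^sub>R r1 - r2)"
    by (metis assms(9) norm_ge_zero real_sqrt_unique)
  \<comment> \<open>The leading coefficient is \<open>r1\<close> divided by \<open>k\<close>, as the
    signs of numerator and denominator cancel. The linear one is \<open>- r2\<close> divided by
    \<open>k\<close>, because \<open>k *\<^sub>R s3 = r1 - r2\<close>.\<close>
  have vel: "vector_derivative r (at t) = (1 / k) *\<^sub>R ((2 * t) *\<^sub>R r1 - r2)" for t
  proof -
    define a where "a = (1 / (T\<^sup>2 - T)) *\<^sub>R (p2 - p1 - T *\<^sub>R (p3 - p1))"
    have "a = (1 / (- k)) *\<^sub>R (- r1)" by (simp add: a_def k_def assms(4-6))
    then have a: "a = (1 / k) *\<^sub>R r1" by simp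
    have "k *\<^sub>R s3 = r1 - r2" by (simp add: k_def assms(6,7) algebra_simps)
    then have "s3 = (1 / k) *\<^sub>R (r1 - r2)"
      using k by (metis eq_vector_fraction_iff less_irrefl scaleR_one vector_fraction_eq_iff)
    then have b: "p3 - p1 - a = - ((1 / k) *\<^sub>R r2)"
      using assms(5) by (simp add: a scaleR_diff_right)
    have "r = (\<lambda>t. t\<^sup>2 *\<^sub>R a + t *\<^sub>R (p3 - p1 - a) + p1)"
      by (simp add: fun_eq_iff assms(3) min_energy_curve_def Let_def a_def flip: assms(2))
    then have "(r has_vector_derivative (2 * t) *\<^sub>R a + (p3 - p1 - a)) (at t)"
      by (auto intro!: derivative_eq_intros)
    then have "vector_derivative r (at t) = (2 * t) *\<^sub>R a + (p3 - p1 - a)"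
      by (rule vector_derivative_at)
    then show ?thesis unfolding b by (simp add: a scaleR_diff_right)
  qed
  have "l = integral {0..1} (\<lambda>t. (1 / k) * norm ((2 * t) *\<^sub>R r1 - r2))"
    using k by (simp add: assms(10) vel)
  also have "\<dots> = (1 / k) * integral {0..1} (\<lambda>t. norm ((2 * t) *\<^sub>R r1 - r2))"
    by (rule integral_mult_right)
  finally show ?thesis
    unfolding integral_norm_linear[OF nc ang] rho[symmetric] k_def[symmetric] by simp
qed

end
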